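(* Let $I\subseteq\mathbb{R}$ and assume $f_1,\dots,f_n\colon I\to\mathbb{R}$ with $$\sum_{i=1}^n f_i(t)=0\quad\text{and}\quad f_1(t)\le f_2(t)\le\dots\le f_n(t)\qquad\text{for all } t\in I$$ and $g\colon I\to\mathbb{R}$ with $$g(t)=\sum_{i=1}^n e^{f_i(t)}\qquad\text{for all } t\in I .$$ (i) If $f_1'(t)\le f_2'(t)\le\dots\le f_n'(t)$ for all $t\in I$, then $g'(t)\ge 0$ for all $t\in I$, respectively $g$ is monotone increasing. (ii) If $f_1'(t)\ge f_2'(t)\ge\dots\ge f_n'(t)$ for all $t\in I$, then $g'(t)\le 0$ for all $t\in I$, respectively $g$ is monotone decreasing.
   Context: A prime denotes the derivative with respect to $t$. "Monotone increasing" and "monotone decreasing" are meant in the weak (non-strict) sense.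
   Formalization: Monotonicity of g is asserted on every interval contained in I, since on a disconnected I it can fail (locally constant f_i with different values on two components); derivatives are taken relative to I, the f_i are assumed differentiable, and every point of I is a limit point of I. *)

theory Defs
  imports "HOL-Analysis.Analysis"
begin

end

theory Submission
  imports Defs
begin

text \<open>
  The derivative of \<open>g\<close> is the sum of the products \<open>exp (f i t) * f' i t\<close>.
  Both factors are monotone in \<open>i\<close>, so Chebyshev's sum inequality compares it with the product
  of the sums of \<open>exp (f i t)\<close> and of \<open>f' i t\<close>; the latter sum vanishes because it is the
  derivative of a constant.
\<close>

text \<open>Chebyshev's sum inequality for oppositely ordered sequences bounds \<open>n\<close>
  times the left-hand sum by the product of the two separate sums, and the factor coming from
  \<open>b\<close> vanishes. Cancelling \<open>n\<close> requires it to be nonzero, hence the case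
  split.\<close>

lemma Chebyshev_sum_nonpos:
  fixes a b :: "nat \<Rightarrow> real"
  assumes a: "\<And>i. i \<in> {1..<n} \<Longrightarrow> a i \<le> a (i + 1)"
    and b: "\<And>i. i \<in> {1..<n} \<Longrightarrow> b i \<ge> b (i + 1)"
    and zero: "(\<Sum>i=1..n. b i) = 0"
  shows "(\<Sum>i=1..n. a i * b i) \<le> 0"
proof (cases "n = 0")
  case False
  \<comment> \<open>\<open>Chebyshev_sum_upper\<close> sums over \<open>0..<n\<close> and compares
    arbitrary pairs of indices. So the sums are shifted by one, and induction extends the comparison
    of neighbours to all pairs.\<close>
  have shift: "(\<Sum>i=1..n. c i) = (\<Sum>i=0..<n. c (Suc i))" for c :: "nat \<Rightarrow> real"
    by (simp add: sum.atLeast1_atMost_eq atLeast0LessThan)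
  have a': "a (Suc i) \<le> a (Suc j)" if "i \<le> j" "j < n" for i j
    using that
  proof (induction j rule: dec_induct)
    case (step j)
    with a[of "Suc j"] show ?case by simp
  qed simp
  have b': "b (Suc i) \<ge> b (Suc j)" if "i \<le> j" "j < n" for i j
    using that
  proof (induction j rule: dec_induct)
    case (step j)
    with b[of "Suc j"] show ?case by simp
  qed simp
  have "real n * (\<Sum>i=1..n. a i * b i) \<le> (\<Sum>i=1..n. a i) * (\<Sum>i=1..n. b i)"
    unfolding shift using a' b' by (rule Chebyshev_sum_upper)
  with zero False show ?thesis
    by (simp add: mult_le_0_iff)
qed simp

text \<open>The mean value argument runs on a segment contained in \<open>I\<close>. A derivative
  within \<open>I\<close> carries no information across a gap of \<open>I\<close>, which is why
  monotonicity is claimed on intervals \<open>J\<close> only.\<close>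

lemma DERIV_within_nonneg_imp_mono_on:
  fixes g g' :: "real \<Rightarrow> real"
  assumes g: "\<And>t. t \<in> I \<Longrightarrow> (g has_real_derivative g' t) (at t within I)"
    and nonneg: "\<And>t. t \<in> I \<Longrightarrow> g' t \<ge> 0"
    and J: "is_interval J" "J \<subseteq> I"
  shows "mono_on J g"
proof (rule mono_onI)
  fix a b assume ab: "a \<in> J" "b \<in> J" "a \<le> b"
  have sub: "{a..b} \<subseteq> I"
  proof
    fix x assume "x \<in> {a..b}"
    then have "x \<in> J"
      using mem_is_interval_1_I[OF J(1) ab(1,2)] by simp
    with J(2) show "x \<in> I" ..
  qed
  show "g a \<le> g b"
  proof (rule DERIV_nonneg_imp_increasing_open[OF \<open>a \<le> b\<close>])
    fix x assume x: "a < x" "x < b"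
    \<comment> \<open>Strictly between \<open>a\<close> and \<open>b\<close> the derivative within
      \<open>I\<close> is an ordinary two-sided one; at the endpoints continuity is enough.\<close>
    then have "x \<in> interior I"
      using interior_mono[OF sub] by auto
    then have "at x within I = at x"
      by (rule at_within_interior)
    moreover have "x \<in> I"
      using x sub by auto
    ultimately show "\<exists>y. (g has_real_derivative y) (at x) \<and> 0 \<le> y"
      using g[of x] nonneg[of x] by auto
  next
    show "continuous_on {a..b} g"
      using g by (intro continuous_on_subset[OF DERIV_continuous_on sub])
  qed
qed

theorem theorem4p3:
  fixes I :: "real set" and n :: nat
    and f f' :: "nat \<Rightarrow> real \<Rightarrow> real" and g :: "real \<Rightarrow> real"
  assumes limpt: "\<And>t. t \<in> I \<Longrightarrow> t islimpt I"
    and deriv_f: "\<And>i t. i \<in> {1..n} \<Longrightarrow> t \<in> I \<Longrightarrow>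
          (f i has_real_derivative f' i t) (at t within I)"
    and sum_zero: "\<And>t. t \<in> I \<Longrightarrow> (\<Sum>i=1..n. f i t) = 0"
    and ordered: "\<And>t i. t \<in> I \<Longrightarrow> i \<in> {1..<n} \<Longrightarrow> f i t \<le> f (i + 1) t"
    and g_eq: "\<And>t. t \<in> I \<Longrightarrow> g t = (\<Sum>i=1..n. exp (f i t))"
  shows "((\<forall>t\<in>I. \<forall>i\<in>{1..<n}. f' i t \<le> f' (i + 1) t) \<longrightarrow>
            (\<exists>g'. \<forall>t\<in>I. (g has_real_derivative g' t) (at t within I) \<and> g' t \<ge> 0) \<and>
            (\<forall>J. is_interval J \<and> J \<subseteq> I \<longrightarrow> mono_on J g)) \<and>
         ((\<forall>t\<in>I. \<forall>i\<in>{1..<n}. f' i t \<ge> f' (i + 1) t) \<longrightarrow>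
            (\<exists>g'. \<forall>t\<in>I. (g has_real_derivative g' t) (at t within I) \<and> g' t \<le> 0) \<and>
            (\<forall>J. is_interval J \<and> J \<subseteq> I \<longrightarrow> antimono_on J g))"
proof -
  define D where "D t = (\<Sum>i=1..n. exp (f i t) * f' i t)" for t
  have g: "(g has_real_derivative D t) (at t within I)" if "t \<in> I" for t
  proof -
    have "((\<lambda>t. \<Sum>i=1..n. exp (f i t)) has_real_derivative D t) (at t within I)"
      unfolding D_def by (intro DERIV_sum DERIV_chain2[OF DERIV_exp] deriv_f that)
    then show ?thesis
      by (rule has_field_derivative_transform_within[OF _ zero_less_one that]) (simp add: g_eq)
  qed
  have zero': "(\<Sum>i=1..n. f' i t) = 0" if "t \<in> I" for t
  proof -
    have "((\<lambda>t. \<Sum>i=1..n. f i t) has_real_derivative (\<Sum>i=1..n. f' i t)) (at t within I)"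
      using that by (intro DERIV_sum deriv_f)
    then have "((\<lambda>_. 0) has_real_derivative (\<Sum>i=1..n. f' i t)) (at t within I)"
      by (rule has_field_derivative_transform_within[OF _ zero_less_one that sum_zero])
    moreover have "((\<lambda>_. 0) has_real_derivative 0) (at t within I)"
      by simp
    \<comment> \<open>At an isolated point of \<open>I\<close> every number would be a derivative;
      \<open>limpt\<close> excludes this, so the derivative of the constant sum must be 0.\<close>
    moreover have "at t within I \<noteq> bot"
      using limpt[OF that] by (simp add: trivial_limit_within)
    ultimately show ?thesis
      by (rule has_field_derivative_unique)
  qed
  have exp_ordered: "exp (f i t) \<le> exp (f (i + 1) t)" if "t \<in> I" "i \<in> {1..<n}" for i t
    using ordered[OF that] by simp
  show ?thesis
  proof (intro conjI impI)
    assume "\<forall>t\<in>I. \<forall>i\<in>{1..<n}. f' i t \<le> f' (i + 1) t"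
    \<comment> \<open>Here both factors increase with \<open>i\<close>; negating \<open>f'\<close>
      produces the opposite orders that \<open>Chebyshev_sum_nonpos\<close> expects and keeps the
      sum zero.\<close>
    then have "(\<Sum>i=1..n. exp (f i t) * - f' i t) \<le> 0" if "t \<in> I" for t
      using that by (intro Chebyshev_sum_nonpos exp_ordered) (auto simp: sum_negf zero' simp del: One_nat_def)
    then have D: "D t \<ge> 0" if "t \<in> I" for t
      using that by (simp add: D_def sum_negf)
    show "\<exists>g'. \<forall>t\<in>I. (g has_real_derivative g' t) (at t within I) \<and> g' t \<ge> 0"
      using g D by blast
    show "\<forall>J. is_interval J \<and> J \<subseteq> I \<longrightarrow> mono_on J g"
      using DERIV_within_nonneg_imp_mono_on[OF g D] by blast
  next
    assume "\<forall>t\<in>I. \<forall>i\<in>{1..<n}. f' i t \<ge> f' (i + 1) t"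
    then have D: "D t \<le> 0" if "t \<in> I" for t
      unfolding D_def using that by (intro Chebyshev_sum_nonpos exp_ordered) (auto simp: zero' simp del: One_nat_def)
    show "\<exists>g'. \<forall>t\<in>I. (g has_real_derivative g' t) (at t within I) \<and> g' t \<le> 0"
      using g D by blast
    \<comment> \<open>The decreasing case reduces to the increasing one for \<open>- g\<close>,
      whose derivative \<open>- D t\<close> is nonnegative.\<close>
    have "mono_on J (\<lambda>t. - g t)" if "is_interval J" "J \<subseteq> I" for J
      using that D
      by (intro DERIV_within_nonneg_imp_mono_on[where g' = "\<lambda>t. - D t" and I = I] DERIV_minus g)
        auto
    then show "\<forall>J. is_interval J \<and> J \<subseteq> I \<longrightarrow> antimono_on J g"
      by (auto simp: monotone_on_def)
  qed
qed

end
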